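(* Suppose $S=\Bbbk[[H]]$ is a far-flung Gorenstein numerical semigroup ring of type $r$. If $e(S)>\overline n(r-1)+1$, then $S$ has maximal reduced type.
   Context: $\Bbbk$ is an algebraically closed field of characteristic $0$. A numerical semigroup is a submonoid $H$ of $\mathbb N=\{0,1,2,\dots\}$ with finite complement; here $H\neq\mathbb N$ (rings in the paper are non-regular) is minimally generated by $b_1<\dots<b_m$, and $S=\Bbbk[[H]]=\Bbbk[[t^{b_1},\dots,t^{b_m}]]\subseteq\overline S=\Bbbk[[t]]$, with maximal ideal $\mathfrak n$ and multiplicity $e(S)=b_1$. The conductor of $S$ is $\mathfrak C=S:_{\operatorname{Frac}(S)}\overline S$. The reduced type is $s(S)=\dim_\Bbbk\frac{\mathfrak C+t^{b_1}S}{t^{b_1}S}$ and the Cohen–Macaulay type is $\operatorname{type}(S)=\dim_\Bbbk\frac{t^{b_1}S:_S\mathfrak n}{t^{b_1}S}$; $S$ is of maximal reduced type if $s(S)=\operatorname{type}(S)$. $S$ is far-flung Gorenstein if the trace ideal of its canonical module $\omega_S$, namely $\sum_{f\in\operatorname{Hom}_S(\omega_S,S)}f(\omega_S)$, equals $\mathfrak C$. (Such rings, being non-regular, are non-Gorenstein, so $r\ge 2$.) Rohrbach number: for a finite set $A$ of non-negative integers, let $A+A=\{a+b: a,b\in A\}$ and let $n(A)$ be the integer such that $A+A$ contains $0,1,\dots,n(A)-1$ but not $n(A)$. Then $\overline n(r)=\max\{n(A): |A|=r\}$, the maximum over sets $A$ of non-negative integers of cardinality $r$. *)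

theory Defs
  imports
    "HOL-Computational_Algebra.Computational_Algebra"
    "HOL-Library.FuncSet"
begin

section \<open>Numerical semigroups and their semigroup rings\<close>

definition numerical_semigroup :: "nat set \<Rightarrow> bool" where
  "numerical_semigroup H \<longleftrightarrow>
     0 \<in> H \<and> (\<forall>a\<in>H. \<forall>b\<in>H. a + b \<in> H) \<and> finite (- H)"

text \<open>The smallest minimal generator of \<open>H\<close>, that is its smallest nonzero element; this is
  the multiplicity of the semigroup ring of \<open>H\<close>.\<close>

definition least_generator :: "nat set \<Rightarrow> nat" where
  "least_generator H = (LEAST h. h \<in> H \<and> h \<noteq> 0)"

text \<open>Everything takes place inside the field \<open>k((t))\<close> of formal Laurent series. The ring
  \<open>k[[H]]\<close> consists of the power series whose support is contained in \<open>H\<close>.\<close>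

definition semigroup_ring :: "nat set \<Rightarrow> 'a::field fls set" where
  "semigroup_ring H = {fps_to_fls f | f. \<forall>n. n \<notin> H \<longrightarrow> fps_nth f n = 0}"

definition power_series_ring :: "'a::field fls set" where
  "power_series_ring = range fps_to_fls"


section \<open>Ideals of a subring of \<open>k((t))\<close>\<close>

definition fraction_field :: "'a::field fls set \<Rightarrow> 'a fls set" where
  "fraction_field S = {a / b | a b. a \<in> S \<and> b \<in> S \<and> b \<noteq> 0}"

text \<open>\<open>colon Q A B\<close> is \<open>A :\<^sub>Q B\<close>.\<close>

definition colon :: "'a::field fls set \<Rightarrow> 'a fls set \<Rightarrow> 'a fls set \<Rightarrow> 'a fls set" where
  "colon Q A B = {q \<in> Q. \<forall>b\<in>B. q * b \<in> A}"

definition conductor :: "'a::field fls set \<Rightarrow> 'a fls set" where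
  "conductor S = colon (fraction_field S) S power_series_ring"

text \<open>The nonunits of \<open>S\<close>; for a local ring \<open>S\<close> they form its maximal ideal.\<close>

definition max_ideal :: "'a::field fls set \<Rightarrow> 'a fls set" where
  "max_ideal S = {f \<in> S. \<not> (\<exists>g\<in>S. f * g = 1)}"

definition principal :: "'a::field fls set \<Rightarrow> 'a fls \<Rightarrow> 'a fls set" where
  "principal S x = {x * s | s. s \<in> S}"

definition ideal_sum :: "'a::field fls set \<Rightarrow> 'a fls set \<Rightarrow> 'a fls set" where
  "ideal_sum A B = {a + b | a b. a \<in> A \<and> b \<in> B}"


section \<open>Reduced type and Cohen--Macaulay type\<close>

text \<open>For \<open>k\<close>-subspaces \<open>B \<subseteq> A\<close> of \<open>k((t))\<close>: the classes of \<open>x 0, \<dots>, x (n - 1)\<close> form a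
  \<open>k\<close>-basis of \<open>A / B\<close>.\<close>

definition quotient_basis ::
    "'a::field fls set \<Rightarrow> 'a fls set \<Rightarrow> nat \<Rightarrow> (nat \<Rightarrow> 'a fls) \<Rightarrow> bool" where
  "quotient_basis A B n x \<longleftrightarrow>
     (\<forall>i<n. x i \<in> A) \<and>
     (\<forall>a\<in>A. \<exists>c. a - (\<Sum>i<n. fls_const (c i) * x i) \<in> B) \<and>
     (\<forall>c. (\<Sum>i<n. fls_const (c i) * x i) \<in> B \<longrightarrow> (\<forall>i<n. c i = 0))"

text \<open>The dimension of \<open>A / B\<close>; only meaningful when it is finite.\<close>

definition quotient_dim :: "'a::field fls set \<Rightarrow> 'a fls set \<Rightarrow> nat" where
  "quotient_dim A B = (THE n. \<exists>x. quotient_basis A B n x)"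

text \<open>The argument \<open>b\<close> below is the multiplicity of \<open>S\<close>, so that \<open>fls_X ^ b\<close> is
  \<open>t\<^sup>b\<close> with \<open>b\<close> the smallest generator of the semigroup.\<close>

definition reduced_type :: "nat \<Rightarrow> 'a::field fls set \<Rightarrow> nat" where
  "reduced_type b S =
     quotient_dim (ideal_sum (conductor S) (principal S (fls_X ^ b))) (principal S (fls_X ^ b))"

definition CM_type :: "nat \<Rightarrow> 'a::field fls set \<Rightarrow> nat" where
  "CM_type b S =
     quotient_dim (colon S (principal S (fls_X ^ b)) (max_ideal S)) (principal S (fls_X ^ b))"

definition maximal_reduced_type :: "nat \<Rightarrow> 'a::field fls set \<Rightarrow> bool" where
  "maximal_reduced_type b S \<longleftrightarrow> reduced_type b S = CM_type b S"


section \<open>Canonical module, trace ideal, far-flung Gorenstein rings\<close>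

definition submodule :: "'a::field fls set \<Rightarrow> 'a fls set \<Rightarrow> bool" where
  "submodule S M \<longleftrightarrow>
     0 \<in> M \<and> (\<forall>u\<in>M. \<forall>v\<in>M. u + v \<in> M) \<and> (\<forall>s\<in>S. \<forall>u\<in>M. s * u \<in> M)"

definition fractional_ideal :: "'a::field fls set \<Rightarrow> 'a fls set \<Rightarrow> bool" where
  "fractional_ideal S I \<longleftrightarrow>
     submodule S I \<and> I \<subseteq> fraction_field S \<and> I \<noteq> {0} \<and>
     (\<exists>d\<in>S. d \<noteq> 0 \<and> (\<forall>u\<in>I. d * u \<in> S))"

text \<open>The canonical module of a one-dimensional Cohen--Macaulay domain, realised as a fractional
  ideal, in the sense of Herzog and Kunz (Der kanonische Modul eines Cohen-Macaulay-Rings):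
  a fractional ideal \<open>K\<close> with \<open>K : (K : I) = I\<close> for all nonzero fractional ideals \<open>I\<close>. It is
  determined up to isomorphism of modules.\<close>

definition canonical_ideal :: "'a::field fls set \<Rightarrow> 'a fls set \<Rightarrow> bool" where
  "canonical_ideal S K \<longleftrightarrow>
     fractional_ideal S K \<and>
     (\<forall>I. fractional_ideal S I \<longrightarrow>
        colon (fraction_field S) K (colon (fraction_field S) K I) = I)"

text \<open>\<open>S\<close>-linear maps \<open>M \<rightarrow> S\<close>; the values outside of \<open>M\<close> are irrelevant.\<close>

definition Hom_to_ring :: "'a::field fls set \<Rightarrow> 'a fls set \<Rightarrow> ('a fls \<Rightarrow> 'a fls) set" where
  "Hom_to_ring S M =
     {f \<in> M \<rightarrow> S. (\<forall>u\<in>M. \<forall>v\<in>M. f (u + v) = f u + f v) \<and>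
                   (\<forall>s\<in>S. \<forall>u\<in>M. f (s * u) = s * f u)}"

text \<open>The sum of the submodules \<open>f ` M\<close>, for \<open>f\<close> ranging over the linear maps \<open>M \<rightarrow> S\<close>.\<close>

definition trace_ideal :: "'a::field fls set \<Rightarrow> 'a fls set \<Rightarrow> 'a fls set" where
  "trace_ideal S M =
     {\<Sum>i<n. f i (w i) | n f w. \<forall>i<(n::nat). f i \<in> Hom_to_ring S M \<and> w i \<in> M}"

text \<open>Isomorphic modules have the same trace ideal, so the choice of \<open>K\<close> does not matter.\<close>

definition far_flung_Gorenstein :: "'a::field fls set \<Rightarrow> bool" where
  "far_flung_Gorenstein S \<longleftrightarrow>
     (\<exists>K. canonical_ideal S K \<and> trace_ideal S K = conductor S)"


section \<open>Rohrbach numbers\<close>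

definition sumset_reach :: "nat set \<Rightarrow> nat" where
  "sumset_reach A = (LEAST n. n \<notin> {a + b | a b. a \<in> A \<and> b \<in> A})"

definition Rohrbach :: "nat \<Rightarrow> nat" where
  "Rohrbach r = Max {sumset_reach A | A. finite A \<and> card A = r}"

end

theory Submission
  imports Defs
begin

text \<open>
  Let \<open>F\<close> be the Frobenius number of \<open>H\<close> and \<open>e\<close> its least generator. The exponents
  \<open>K = {k. F - k \<notin> H}\<close> span the standard canonical ideal, and every canonical ideal is
  isomorphic to it. If \<open>k[[H]]\<close> is far-flung Gorenstein, every monomial multiplying the standard
  canonical ideal into the ring lies in the conductor, which says exactly that every natural number
  is a sum of two elements of \<open>K\<close>. In particular the sumset of
  \<open>A = {k \<in> K. k < e}\<close> contains \<open>0, \<dots>, e - 1\<close>.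
  Now \<open>k \<mapsto> F - k\<close> maps \<open>A\<close> onto the gaps of \<open>H\<close> above \<open>F - e\<close>, whose number is the reduced
  type, and these are pseudo-Frobenius numbers, whose number is the type. So if the reduced
  type were smaller than \<open>r\<close>, then \<open>A\<close> would show that the Rohrbach number of \<open>r - 1\<close> is at
  least \<open>e\<close>.
\<close>

section \<open>Laurent series with prescribed support\<close>

definition fls_on :: "int set \<Rightarrow> 'a::zero fls set" where
  "fls_on X = {f. \<forall>n. n \<notin> X \<longrightarrow> fls_nth f n = 0}"

lemma fls_onI: "(\<And>n. n \<notin> X \<Longrightarrow> fls_nth f n = 0) \<Longrightarrow> f \<in> fls_on X"
  and fls_onD: "f \<in> fls_on X \<Longrightarrow> n \<notin> X \<Longrightarrow> fls_nth f n = 0"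
  by (auto simp: fls_on_def)

lemma fls_X_intpow_in_fls_on: "i \<in> X \<Longrightarrow> fls_X_intpow i \<in> (fls_on X :: 'a::{zero,one} fls set)"
  by (auto simp: fls_on_def)

lemma fls_on_mono: "X \<subseteq> Y \<Longrightarrow> fls_on X \<subseteq> fls_on Y"
  by (auto simp: fls_on_def)

lemma zero_in_fls_on [simp]: "0 \<in> fls_on X"
  by (simp add: fls_on_def)

lemma one_in_fls_on: "0 \<in> X \<Longrightarrow> 1 \<in> (fls_on X :: 'a::{zero,one} fls set)"
  by (auto simp: fls_on_def)

lemma add_in_fls_on:
  "f \<in> fls_on X \<Longrightarrow> g \<in> fls_on X \<Longrightarrow> f + g \<in> (fls_on X :: 'a::monoid_add fls set)"
  by (simp add: fls_on_def)

lemma mult_in_fls_on: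
  fixes f g :: "'a::semiring_0 fls"
  assumes "f \<in> fls_on X" "g \<in> fls_on Y" "\<And>x y. x \<in> X \<Longrightarrow> y \<in> Y \<Longrightarrow> x + y \<in> Z"
  shows "f * g \<in> fls_on Z"
proof (rule fls_onI)
  fix n assume n: "n \<notin> Z"
  have "fls_nth f i * fls_nth g (n - i) = 0" for i
  proof -
    have "i \<notin> X \<or> n - i \<notin> Y" using assms(3)[of i "n - i"] n by auto
    then show ?thesis using assms(1,2) by (auto simp: fls_on_def)
  qed
  then show "fls_nth (f * g) n = 0" by (simp add: fls_times_nth(2))
qed

lemma fls_X_intpow_mult_nth:
  "fls_nth (fls_X_intpow i * f) n = fls_nth (f :: 'a::semiring_1 fls) (n - i)"
  "fls_nth (f * fls_X_intpow i) n = fls_nth f (n - i)"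
  by (simp_all add: fls_X_intpow_times_conv_shift)

lemma fls_on_atLeast_iff: "f \<in> fls_on {n..} \<longleftrightarrow> f = 0 \<or> n \<le> fls_subdegree f"
proof
  assume "f \<in> fls_on {n..}"
  then show "f = 0 \<or> n \<le> fls_subdegree f"
    by (auto simp: fls_on_def intro!: fls_subdegree_geI)
next
  assume "f = 0 \<or> n \<le> fls_subdegree f"
  then show "f \<in> fls_on {n..}"
    by (auto simp: fls_on_def)
qed

section \<open>Linear algebra over k: dimensions of quotients\<close>

global_interpretation fls_vs: vector_space "\<lambda>(c::'a::field) f. fls_const c * f"
  by unfold_locales (simp_all add: algebra_simps flip: fls_const_mult_const fls_plus_const)

text \<open>With the field itself as second space, the linear maps of this pair are the k-linear
  functionals on Laurent series.\<close>

global_interpretation fls_functional: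
  vector_space_pair "\<lambda>(c::'a::field) f. fls_const c * f" "(*) :: 'a \<Rightarrow> 'a \<Rightarrow> 'a"
  by unfold_locales (simp_all add: algebra_simps)

text \<open>Bridges the indexed families of \<open>quotient_basis\<close> and the library's
  independent sets, where a repeated vector would go unnoticed; hence the separate injectivity
  claim.\<close>

lemma (in vector_space) independent_family:
  assumes "\<And>c. (\<Sum>i<n. c i *s v i) = 0 \<Longrightarrow> \<forall>i<n. c i = 0"
  shows "inj_on v {..<n}" "independent (v ` {..<n::nat})"
proof -
  show inj: "inj_on v {..<n}"
  proof (rule inj_onI, rule ccontr)
    fix i j assume ij: "i \<in> {..<n}" "j \<in> {..<n}" "v i = v j" "i \<noteq> j"
    define c :: "nat \<Rightarrow> 'a" where "c = (\<lambda>k. if k = i then 1 else if k = j then - 1 else 0)"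
    have "(\<Sum>k<n. c k *s v k) = (\<Sum>k\<in>{i,j}. c k *s v k)"
      using ij by (intro sum.mono_neutral_right) (auto simp: c_def)
    also have "\<dots> = 0" using ij by (simp add: c_def)
    finally have "c i = 0" using assms ij by blast
    then show False by (simp add: c_def)
  qed
  show "independent (v ` {..<n})"
  proof (rule independent_if_scalars_zero)
    fix f x assume *: "(\<Sum>x\<in>v ` {..<n}. f x *s x) = 0" "x \<in> v ` {..<n}"
    then have "(\<Sum>i<n. f (v i) *s v i) = 0" by (simp add: sum.reindex[OF inj])
    then show "f x = 0" using assms[of "\<lambda>i. f (v i)"] *(2) by auto
  qed simp
qed

text \<open>Within \<open>fls_on X\<close>, the projection \<open>p\<close> to the exponents in
  \<open>X - Y\<close> has kernel \<open>fls_on Y\<close>, so it turns a basis of the quotient into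
  a basis of \<open>fls_on (X - Y)\<close>. This yields the uniqueness behind the \<open>THE\<close>
  in \<open>quotient_dim\<close>.\<close>

lemma quotient_basis_fls_on_card:
  fixes x :: "nat \<Rightarrow> 'a::field fls"
  assumes "Y \<subseteq> X" "finite (X - Y)" and qb: "quotient_basis (fls_on X) (fls_on Y) n x"
  shows "n = fls_vs.dim (fls_on (X - Y) :: 'a fls set)"
proof -
  define p :: "'a fls \<Rightarrow> 'a fls"
    where "p f = (\<Sum>z\<in>X - Y. fls_const (fls_nth f z) * fls_X_intpow z)" for f
  have p_nth: "fls_nth (p f) k = (if k \<in> X - Y then fls_nth f k else 0)" for f k
    using assms(2) by (simp add: p_def fls_nth_sum if_distrib[of "(*) _"] sum.delta' cong: if_cong)
  have p_sum: "p (\<Sum>i<n. fls_const (c i) * x i) = (\<Sum>i<n. fls_const (c i) * p (x i))" for c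
    by (rule fls_eqI) (auto simp: p_nth fls_nth_sum intro!: sum.neutral)
  have xX: "(\<Sum>i<n. fls_const (c i) * x i) \<in> fls_on X" for c
    using qb by (auto simp: quotient_basis_def fls_on_def fls_nth_sum)
  have ind: "\<forall>i<n. c i = 0" if "(\<Sum>i<n. fls_const (c i) * p (x i)) = 0" for c
  proof -
    let ?s = "\<Sum>i<n. fls_const (c i) * x i"
    have "?s \<in> fls_on Y"
    proof (rule fls_onI)
      fix k assume "k \<notin> Y"
      moreover have "fls_nth (p ?s) k = 0" using that p_sum[of c] by simp
      ultimately show "fls_nth ?s k = 0" using xX[of c] p_nth[of ?s k]
        by (cases "k \<in> X") (auto dest: fls_onD)
    qed
    then show ?thesis using qb by (simp add: quotient_basis_def)
  qed
  note fam = fls_vs.independent_family[where n = n and v = "\<lambda>i. p (x i)", OF ind]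
  have "fls_vs.dim (fls_on (X - Y) :: 'a fls set) = n"
  proof (rule fls_vs.dim_unique[of "(\<lambda>i. p (x i)) ` {..<n}"])
    show "(\<lambda>i. p (x i)) ` {..<n} \<subseteq> fls_on (X - Y)"
      by (auto simp: fls_on_def p_nth)
    show "fls_on (X - Y) \<subseteq> fls_vs.span ((\<lambda>i. p (x i)) ` {..<n})"
    proof
      fix f :: "'a fls" assume f: "f \<in> fls_on (X - Y)"
      then have "f \<in> fls_on X" using fls_on_mono[of "X - Y" X] by blast
      then obtain c where c: "f - (\<Sum>i<n. fls_const (c i) * x i) \<in> fls_on Y"
        using qb by (auto simp: quotient_basis_def)
      have "f = p (\<Sum>i<n. fls_const (c i) * x i)"
      proof (rule fls_eqI)
        fix k
        show "fls_nth f k = fls_nth (p (\<Sum>i<n. fls_const (c i) * x i)) k"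
          using fls_onD[OF f, of k] fls_onD[OF c, of k] by (auto simp: p_nth)
      qed
      also have "\<dots> = (\<Sum>i<n. fls_const (c i) * p (x i))" by (rule p_sum)
      also have "\<dots> \<in> fls_vs.span ((\<lambda>i. p (x i)) ` {..<n})"
        by (intro fls_vs.span_sum fls_vs.span_scale fls_vs.span_base) auto
      finally show "f \<in> fls_vs.span ((\<lambda>i. p (x i)) ` {..<n})" .
    qed
    show "fls_vs.independent ((\<lambda>i. p (x i)) ` {..<n})" by (rule fam(2))
    show "card ((\<lambda>i. p (x i)) ` {..<n}) = n" using card_image[OF fam(1)] by simp
  qed
  then show ?thesis ..
qed

text \<open>The monomials with exponents in \<open>X - Y\<close>, enumerated by \<open>h\<close>,
  form such a basis.\<close>

lemma quotient_basis_fls_on_exists: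
  assumes "Y \<subseteq> X" "finite (X - Y)"
  shows "\<exists>x. quotient_basis (fls_on X) (fls_on Y :: 'a::field fls set) (card (X - Y)) x"
proof -
  define n where "n = card (X - Y)"
  obtain h where h: "bij_betw h {..<n} (X - Y)"
    using ex_bij_betw_nat_finite[OF assms(2)] by (auto simp: n_def atLeast0LessThan)
  define x :: "nat \<Rightarrow> 'a fls" where "x i = fls_X_intpow (h i)" for i
  have nth: "fls_nth (\<Sum>i<n. fls_const (c i) * x i) k = (\<Sum>i<n. if h i = k then c i else 0)" for c k
    by (auto simp: fls_nth_sum x_def intro!: sum.cong)
  have nth_h: "fls_nth (\<Sum>i<n. fls_const (c i) * x i) (h j) = c j" if "j < n" for c j
  proof -
    have "(\<Sum>i<n. if h i = h j then c i else 0) = (\<Sum>i<n. if i = j then c i else 0)"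
      using that bij_betw_imp_inj_on[OF h] by (intro sum.cong) (auto dest: inj_onD)
    then show ?thesis using that by (simp add: nth)
  qed
  have "quotient_basis (fls_on X) (fls_on Y) n x"
    unfolding quotient_basis_def
  proof (intro conjI allI impI ballI)
    fix i assume "i < n"
    then have "h i \<in> X" using bij_betwE[OF h] by auto
    then show "x i \<in> fls_on X" by (simp add: x_def fls_X_intpow_in_fls_on)
  next
    fix f :: "'a fls" assume f: "f \<in> fls_on X"
    have "f - (\<Sum>i<n. fls_const (fls_nth f (h i)) * x i) \<in> fls_on Y"
    proof (rule fls_onI)
      fix k assume k: "k \<notin> Y"
      show "fls_nth (f - (\<Sum>i<n. fls_const (fls_nth f (h i)) * x i)) k = 0"
      proof (cases "k \<in> X")
        case True
        then obtain j where "j < n" "k = h j"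
          using h k by (auto simp: bij_betw_def image_iff set_eq_iff)
        then show ?thesis using nth_h[of j "\<lambda>i. fls_nth f (h i)"] by simp
      next
        case False
        then have "h i \<noteq> k" if "i < n" for i using that bij_betwE[OF h] by auto
        then have "(\<Sum>i<n. if h i = k then fls_nth f (h i) else 0) = 0"
          by (intro sum.neutral) auto
        then show ?thesis using False f nth[of "\<lambda>i. fls_nth f (h i)" k] by (simp add: fls_onD)
      qed
    qed
    then show "\<exists>c. f - (\<Sum>i<n. fls_const (c i) * x i) \<in> fls_on Y"
      by (rule exI[where x = "\<lambda>i. fls_nth f (h i)"])
  next
    fix c i assume *: "(\<Sum>i<n. fls_const (c i) * x i) \<in> fls_on Y" "i < n"
    have "h i \<notin> Y" using bij_betwE[OF h] *(2) by auto
    then show "c i = 0" using nth_h[OF *(2), of c] fls_onD[OF *(1)] by metis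
  qed
  then show ?thesis by (auto simp: n_def)
qed

lemma quotient_dim_fls_on:
  assumes "Y \<subseteq> X" "finite (X - Y)"
  shows "quotient_dim (fls_on X) (fls_on Y :: 'a::field fls set) = card (X - Y)"
  unfolding quotient_dim_def
proof (rule the_equality)
  show ex: "\<exists>x. quotient_basis (fls_on X) (fls_on Y :: 'a fls set) (card (X - Y)) x"
    by (rule quotient_basis_fls_on_exists[OF assms])
  fix n assume "\<exists>x. quotient_basis (fls_on X) (fls_on Y :: 'a fls set) n x"
  then show "n = card (X - Y)"
    using ex quotient_basis_fls_on_card[OF assms] by metis
qed

section \<open>Linear functionals on Laurent series\<close>

lemma separating_functional:
  fixes f :: "'a::field fls"
  assumes "fls_vs.subspace I" "f \<notin> I"
  obtains \<phi> :: "'a fls \<Rightarrow> 'a" where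
    "Vector_Spaces.linear (\<lambda>c f. fls_const c * f) (*) \<phi>" "\<And>u. u \<in> I \<Longrightarrow> \<phi> u = 0" "\<phi> f = 1"
proof -
  obtain B where B: "B \<subseteq> I" "fls_vs.independent B" "I \<subseteq> fls_vs.span B"
    by (rule fls_vs.maximal_independent_subset)
  \<comment> \<open>\<open>B\<close> is a basis of \<open>I\<close>, so \<open>f\<close> can be
    adjoined to it; prescribing 0 on \<open>B\<close> and 1 at \<open>f\<close> then determines a
    functional that extends to all series.\<close>
  have "f \<notin> fls_vs.span B"
    using assms fls_vs.span_minimal[OF B(1)] by auto
  then have "fls_vs.independent (insert f B)"
    using B(2) by (rule fls_vs.independent_insertI)
  from fls_functional.linear_independent_extend[OF this, of "\<lambda>x. if x = f then 1 else 0"]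
  obtain \<phi> where \<phi>: "Vector_Spaces.linear (\<lambda>c f. fls_const c * f) (*) \<phi>"
    "\<forall>x\<in>insert f B. \<phi> x = (if x = f then 1 else 0)"
    by (elim exE conjE)
  have "f \<notin> B" using assms(2) B(1) by auto
  show ?thesis
  proof (rule that[OF \<phi>(1)])
    show "\<phi> f = 1" using \<phi>(2) by simp
    fix u assume "u \<in> I"
    then have "u \<in> fls_vs.span B" using B(3) by auto
    moreover have "\<phi> x = 0" if "x \<in> B" for x using \<phi>(2) \<open>f \<notin> B\<close> that by auto
    ultimately show "\<phi> u = 0" by (rule fls_functional.linear_eq_0_on_span[OF \<phi>(1), rotated])
  qed
qed

text \<open>The functional \<open>\<phi>\<close> is represented by the series \<open>\<Sum>\<^sub>n \<phi> (t\<^bsup>F - n\<^esup>) t\<^sup>n\<close>.\<close>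

lemma functional_as_coefficient:
  fixes \<phi> :: "'a::field fls \<Rightarrow> 'a"
  assumes lin: "Vector_Spaces.linear (\<lambda>c f. fls_const c * f) (*) \<phi>"
    and van: "\<And>u. u \<in> fls_on {N..} \<Longrightarrow> \<phi> u = 0"
  obtains g where "\<And>u. fls_nth (u * g) F = \<phi> u"
proof -
  define g where "g = Abs_fls (\<lambda>n. \<phi> (fls_X_intpow (F - n)))"
  \<comment> \<open>High monomials are killed, so the coefficients of \<open>g\<close> vanish far to
    the left and \<open>Abs_fls\<close> yields a genuine Laurent series.\<close>
  have g0: "\<phi> (fls_X_intpow (F - n)) = 0" if "n \<le> F - N" for n
    using that by (intro van fls_X_intpow_in_fls_on) auto
  have g_nth: "fls_nth g n = \<phi> (fls_X_intpow (F - n))" for n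
    unfolding g_def by (rule nth_Abs_fls_lower_bound[of "F - N"]) (use g0 in auto)
  show ?thesis
  proof
    fix u :: "'a fls"
    \<comment> \<open>Linearity handles finite sums only. So \<open>u\<close> is cut off at
      \<open>N\<close>; the discarded tail is killed by \<phi>.\<close>
    define w where "w = (\<Sum>i = fls_subdegree u..<N. fls_const (fls_nth u i) * fls_X_intpow i)"
    have "fls_nth w k = (if k < N then fls_nth u k else 0)" for k
    proof -
      have "fls_nth w k = (\<Sum>i = fls_subdegree u..<N. if k = i then fls_nth u i else 0)"
        unfolding w_def fls_nth_sum by (rule sum.cong) auto
      then show ?thesis by simp
    qed
    then have "\<phi> (u - w) = 0"
      by (intro van fls_onI) simp
    then have "\<phi> u = \<phi> w"
      using fls_functional.linear_diff[OF lin, of u w] by simp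
    also have "\<dots> = (\<Sum>i = fls_subdegree u..<N. fls_nth u i * \<phi> (fls_X_intpow i))"
      unfolding w_def
      by (simp add: fls_functional.linear_sum[OF lin] fls_functional.linear_scale[OF lin])
    \<comment> \<open>Where the two index ranges differ, the terms vanish: by \<open>g0\<close> for
      \<open>i\<close> at least \<open>N\<close>, and by the order of \<open>g\<close> for
      \<open>i\<close> beyond the new upper end.\<close>
    also have "\<dots> = (\<Sum>i = fls_subdegree u..F - fls_subdegree g. fls_nth u i * fls_nth g (F - i))"
    proof (rule sum.mono_neutral_cong)
      fix i assume "i \<in> {fls_subdegree u..F - fls_subdegree g} - {fls_subdegree u..<N}"
      then show "fls_nth u i * fls_nth g (F - i) = 0" using g0[of "F - i"] by (auto simp: g_nth)
    next
      fix i assume "i \<in> {fls_subdegree u..<N} - {fls_subdegree u..F - fls_subdegree g}"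
      then have "fls_nth g (F - i) = 0" by (intro fls_eq0_below_subdegree) auto
      then show "fls_nth u i * \<phi> (fls_X_intpow i) = 0" by (simp add: g_nth)
    qed (auto simp: g_nth)
    also have "\<dots> = fls_nth (u * g) F" by (simp add: fls_times_nth(2))
    finally show "fls_nth (u * g) F = \<phi> u" ..
  qed
qed

section \<open>Rings and ideals spanned by monomials\<close>

lemma semigroup_ring_eq_fls_on: "semigroup_ring H = fls_on (int ` H)"
proof (intro equalityI subsetI)
  fix f :: "'a fls" assume "f \<in> semigroup_ring H"
  then obtain g where g: "f = fps_to_fls g" "\<forall>n. n \<notin> H \<longrightarrow> fps_nth g n = 0"
    by (auto simp: semigroup_ring_def)
  show "f \<in> fls_on (int ` H)"
  proof (rule fls_onI)
    fix n assume "n \<notin> int ` H"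
    then have "nat n \<notin> H" if "0 \<le> n" using imageI[of "nat n" H int] that by auto
    then show "fls_nth f n = 0" using g by (auto simp: not_less)
  qed
next
  fix f :: "'a fls" assume f: "f \<in> fls_on (int ` H)"
  have "fps_to_fls (fls_regpart f) = f"
  proof (rule fls_eqI)
    fix n
    have "n < 0 \<Longrightarrow> fls_nth f n = 0" by (rule fls_onD[OF f]) auto
    then show "fls_nth (fps_to_fls (fls_regpart f)) n = fls_nth f n" by auto
  qed
  moreover have "\<forall>n. n \<notin> H \<longrightarrow> fps_nth (fls_regpart f) n = 0"
    by (auto intro!: fls_onD[OF f])
  ultimately show "f \<in> semigroup_ring H"
    unfolding semigroup_ring_def by (intro CollectI exI[of _ "fls_regpart f"]) simp
qed

lemma power_series_ring_eq_fls_on: "power_series_ring = fls_on {0..}"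
proof -
  have "power_series_ring = semigroup_ring UNIV"
    by (auto simp: power_series_ring_def semigroup_ring_def)
  moreover have "range int = {0..}" by (auto simp: image_iff intro: zero_le_imp_eq_int)
  ultimately show ?thesis by (simp add: semigroup_ring_eq_fls_on)
qed

lemma principal_fls_on:
  "principal (fls_on X) (fls_X ^ b) = (fls_on ((+) (int b) ` X) :: 'a::field fls set)"
proof (intro equalityI subsetI)
  fix f :: "'a fls" assume "f \<in> principal (fls_on X) (fls_X ^ b)"
  then obtain s where s: "s \<in> fls_on X" "f = fls_X ^ b * s" by (auto simp: principal_def)
  show "f \<in> fls_on ((+) (int b) ` X)"
  proof (rule fls_onI)
    fix n assume "n \<notin> (+) (int b) ` X"
    then have "n - int b \<notin> X" using imageI[of "n - int b" X "(+) (int b)"] by auto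
    then show "fls_nth f n = 0"
      using s by (simp add: fls_X_power_times_conv_shift fls_onD)
  qed
next
  fix f :: "'a fls" assume f: "f \<in> fls_on ((+) (int b) ` X)"
  have "fls_shift (int b) f \<in> fls_on X"
    by (rule fls_onI) (auto intro!: fls_onD[OF f])
  moreover have "f = fls_X ^ b * fls_shift (int b) f"
    by (simp add: fls_X_power_times_conv_shift)
  ultimately show "f \<in> principal (fls_on X) (fls_X ^ b)"
    unfolding principal_def by blast
qed

lemma ideal_sum_fls_on:
  "ideal_sum (fls_on X) (fls_on Y) = (fls_on (X \<union> Y) :: 'a::field fls set)" if "finite (X - Y)"
proof (intro equalityI subsetI)
  fix f :: "'a fls" assume "f \<in> ideal_sum (fls_on X) (fls_on Y)"
  then show "f \<in> fls_on (X \<union> Y)" by (auto simp: ideal_sum_def fls_on_def)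
next
  fix f :: "'a fls" assume f: "f \<in> fls_on (X \<union> Y)"
  \<comment> \<open>The part of \<open>f\<close> on \<open>X - Y\<close>; finiteness makes it a sum
    of monomials, and what remains of \<open>f\<close> is supported in \<open>Y\<close>.\<close>
  define g where "g = (\<Sum>i\<in>X - Y. fls_const (fls_nth f i) * fls_X_intpow i)"
  have g_nth: "fls_nth g n = (if n \<in> X - Y then fls_nth f n else 0)" for n
  proof -
    have "fls_nth g n = (\<Sum>i\<in>X - Y. if n = i then fls_nth f i else 0)"
      unfolding g_def fls_nth_sum by (rule sum.cong) auto
    then show ?thesis using that by simp
  qed
  have "g \<in> fls_on X" "f - g \<in> fls_on Y"
    using f by (auto simp: fls_on_def g_nth)
  moreover have "f = g + (f - g)" by simp
  ultimately show "f \<in> ideal_sum (fls_on X) (fls_on Y)"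
    unfolding ideal_sum_def by blast
qed

section \<open>Rohrbach numbers\<close>

lemma sumset_reach_ge:
  assumes "finite A" "\<And>n. n < m \<Longrightarrow> \<exists>a\<in>A. \<exists>b\<in>A. n = a + b"
  shows "m \<le> sumset_reach A"
proof -
  let ?P = "\<lambda>n. n \<notin> {a + b | a b. a \<in> A \<and> b \<in> A}"
  have "finite {a + b | a b. a \<in> A \<and> b \<in> A}"
    using assms(1) by (intro finite_image_set2) simp_all
  then obtain n where "?P n" using ex_new_if_finite[OF infinite_UNIV_nat] by blast
  then have "?P (sumset_reach A)" unfolding sumset_reach_def by (rule LeastI)
  then show ?thesis using assms(2)[of "sumset_reach A"] by (force simp: not_le)
qed

text \<open>Bounds the reach in terms of the cardinality alone, so that the \<open>Max\<close> in
  \<open>Rohrbach\<close> ranges over a finite set.\<close>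

lemma sumset_reach_le:
  assumes "finite A"
  shows "sumset_reach A \<le> card A * card A"
proof -
  let ?S = "{a + b | a b. a \<in> A \<and> b \<in> A}"
  have S: "?S = (\<lambda>(a, b). a + b) ` (A \<times> A)" by auto
  have "{..<sumset_reach A} \<subseteq> ?S"
  proof
    fix n assume "n \<in> {..<sumset_reach A}"
    then have "\<not> n \<notin> ?S" unfolding sumset_reach_def lessThan_iff by (rule not_less_Least)
    then show "n \<in> ?S" by blast
  qed
  then have "card {..<sumset_reach A} \<le> card ?S"
    using assms unfolding S by (intro card_mono) auto
  also have "\<dots> \<le> card (A \<times> A)"
    unfolding S by (rule card_image_le) (use assms in auto)
  finally show ?thesis by (simp add: card_cartesian_product)
qed

text \<open>Padding \<open>A\<close> with arbitrary new numbers up to cardinality \<open>r\<close>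
  loses no sums, so an upper bound on \<open>card A\<close> suffices.\<close>

lemma Rohrbach_ge:
  assumes "finite A" "card A \<le> r" "\<And>n. n < m \<Longrightarrow> \<exists>a\<in>A. \<exists>b\<in>A. n = a + b"
  shows "m \<le> Rohrbach r"
proof -
  have "infinite (- A)" using assms(1) by (simp add: finite_compl)
  then obtain C where C: "finite C" "card C = r - card A" "C \<subseteq> - A"
    using infinite_arbitrarily_large by blast
  then have "card (A \<union> C) = r"
    using assms(1,2) by (subst card_Un_disjoint) auto
  then obtain B where B: "A \<subseteq> B" "finite B" "card B = r"
    using assms(1) C(1) by (metis Un_upper1 finite_UnI)
  have "m \<le> sumset_reach B"
    using B(1,2) assms(3) by (intro sumset_reach_ge) blast+
  also have "\<dots> \<le> Rohrbach r"
    unfolding Rohrbach_def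
  proof (rule Max_ge)
    show "finite {sumset_reach A | A. finite A \<and> card A = r}"
      by (rule finite_subset[of _ "{..r * r}"]) (auto dest: sumset_reach_le)
    show "sumset_reach B \<in> {sumset_reach A | A. finite A \<and> card A = r}"
      using B by blast
  qed
  finally show ?thesis .
qed

section \<open>The ring of a numerical semigroup\<close>

locale proper_numerical_semigroup =
  fixes H :: "nat set"
  assumes ns: "numerical_semigroup H" and proper: "H \<noteq> UNIV"
begin

text \<open>Integer exponents make differences such as \<open>F - k\<close> and \<open>x - e\<close>
  available without truncation.\<close>

definition G :: "int set" where "G = int ` H"

definition F :: int where "F = int (Max (- H))"

definition e :: int where "e = int (least_generator H)"

text \<open>The pseudo-Frobenius numbers; shifted by \<open>e\<close>, they are the exponents of a
  monomial basis of the socle of the ring modulo t^e.\<close>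

definition PF :: "int set" where "PF = {x. x \<notin> G \<and> (\<forall>h\<in>G - {0}. x + h \<in> G)}"

definition L :: "int set" where "L = {x. x \<notin> G \<and> F - e < x}"

lemma zero_in_G [simp]: "0 \<in> G"
  using ns by (force simp: G_def numerical_semigroup_def)

lemma G_add: "a \<in> G \<Longrightarrow> b \<in> G \<Longrightarrow> a + b \<in> G"
  using ns unfolding G_def numerical_semigroup_def
  by (auto simp flip: of_nat_add)

lemma G_nonneg: "a \<in> G \<Longrightarrow> 0 \<le> a"
  by (auto simp: G_def)

lemma G_gt: "F < a \<Longrightarrow> a \<in> G"
proof -
  assume a: "F < a"
  have fin: "finite (- H)" using ns by (simp add: numerical_semigroup_def)
  have "nat a \<in> H"
  proof (rule ccontr)
    assume "nat a \<notin> H"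
    then have "nat a \<le> Max (- H)" using fin by simp
    then show False using a unfolding F_def by linarith
  qed
  moreover have "a = int (nat a)" using a by (simp add: F_def)
  ultimately show ?thesis unfolding G_def by blast
qed

lemma F_notin_G: "F \<notin> G"
proof -
  have "Max (- H) \<in> - H"
    using ns proper by (intro Max_in) (auto simp: numerical_semigroup_def)
  then show ?thesis by (auto simp: F_def G_def)
qed

lemma notin_G_le: "a \<notin> G \<Longrightarrow> a \<le> F"
  using G_gt by force

lemma least_generator: "least_generator H \<in> H" "least_generator H \<noteq> 0"
  and least_generator_le: "h \<in> H \<Longrightarrow> h \<noteq> 0 \<Longrightarrow> least_generator H \<le> h"
proof -
  have "int (Suc (Max (- H))) \<in> G" by (rule G_gt) (simp add: F_def)
  then have "Suc (Max (- H)) \<in> H"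
    unfolding G_def by (simp only: inj_image_mem_iff[OF inj_of_nat])
  then have "Suc (Max (- H)) \<in> H \<and> Suc (Max (- H)) \<noteq> 0" by simp
  then have "least_generator H \<in> H \<and> least_generator H \<noteq> 0"
    unfolding least_generator_def by (rule LeastI)
  then show "least_generator H \<in> H" "least_generator H \<noteq> 0" by auto
  show "h \<in> H \<Longrightarrow> h \<noteq> 0 \<Longrightarrow> least_generator H \<le> h"
    unfolding least_generator_def by (rule Least_le) simp
qed

lemma e_in_G: "e \<in> G" and e_pos: "0 < e"
  using least_generator by (auto simp: e_def G_def)

lemma e_le: "g \<in> G \<Longrightarrow> g \<noteq> 0 \<Longrightarrow> e \<le> g"
  using least_generator_le by (auto simp: e_def G_def)

text \<open>A nonzero \<open>h\<close> in \<open>G\<close> is at least \<open>e\<close>, so it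
  carries any number above \<open>F - e\<close> past \<open>F\<close>.\<close>

lemma L_subset_PF: "L \<subseteq> PF"
  by (force simp: L_def PF_def dest: e_le intro!: G_gt)

lemma finite_PF: "finite PF"
proof (rule finite_subset)
  show "PF \<subseteq> {- e..F}"
  proof
    fix x assume x: "x \<in> PF"
    then have "x + e \<in> G" using e_in_G e_pos by (auto simp: PF_def)
    then show "x \<in> {- e..F}" using G_nonneg notin_G_le x by (force simp: PF_def)
  qed
qed simp

section \<open>Canonical ideals\<close>

text \<open>The exponents of the standard canonical ideal.\<close>

definition K :: "int set" where "K = {k. F - k \<notin> G}"

lemma zero_in_K [simp]: "0 \<in> K"
  by (simp add: K_def F_notin_G)

lemma K_nonneg: "k \<in> K \<Longrightarrow> 0 \<le> k"
  using notin_G_le[of "F - k"] by (simp add: K_def)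

lemma K_add_G: "k \<in> K \<Longrightarrow> g \<in> G \<Longrightarrow> k + g \<in> K"
  using G_add[of "F - (k + g)" g] by (auto simp: K_def)

section \<open>Fraction field, conductor, maximal ideal and socle\<close>

lemma fraction_field_ring: "fraction_field (fls_on G :: 'a::field fls set) = UNIV"
proof (rule UNIV_eq_I[symmetric])
  fix f :: "'a fls"
  \<comment> \<open>Chosen so that both t^m and t^m times \<open>f\<close> have only exponents above
    \<open>F\<close>, which puts them in the ring.\<close>
  define m where "m = F + 1 - min 0 (fls_subdegree f)"
  have m: "F + 1 \<le> m" "F + 1 \<le> m + fls_subdegree f" by (auto simp: m_def)
  have "fls_X_intpow m * f \<in> fls_on G"
  proof (rule fls_onI)
    fix n assume "n \<notin> G"
    then show "fls_nth (fls_X_intpow m * f) n = 0"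
      using m notin_G_le[of n]
      by (simp add: fls_X_intpow_mult_nth)
  qed
  moreover have "fls_X_intpow m \<in> (fls_on G :: 'a fls set)"
    using m by (intro fls_X_intpow_in_fls_on G_gt) auto
  moreover have "f = (fls_X_intpow m * f) / fls_X_intpow m"
    by (simp add: fls_divide_X_intpow fls_X_intpow_times_conv_shift)
  moreover have "fls_X_intpow m \<noteq> (0 :: 'a fls)" by simp
  ultimately show "f \<in> fraction_field (fls_on G)"
    unfolding fraction_field_def by blast
qed

lemma conductor_ring: "conductor (fls_on G) = (fls_on {F<..} :: 'a::field fls set)"
proof (intro equalityI subsetI)
  fix f :: "'a fls" assume "f \<in> conductor (fls_on G)"
  then have f: "f * g \<in> fls_on G" if "g \<in> fls_on {0..}" for g
    using that by (auto simp: conductor_def colon_def power_series_ring_eq_fls_on)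
  show "f \<in> fls_on {F<..}"
  proof (rule fls_onI)
    fix n assume "n \<notin> {F<..}"
    \<comment> \<open>As \<open>n\<close> is at most \<open>F\<close>, this is a power series;
      multiplying by it moves the coefficient at \<open>n\<close> to the gap
      \<open>F\<close>.\<close>
    then have "fls_X_intpow (F - n) \<in> (fls_on {0..} :: 'a fls set)"
      by (intro fls_X_intpow_in_fls_on) auto
    then have "fls_nth (f * fls_X_intpow (F - n)) F = 0"
      using f F_notin_G by (blast dest: fls_onD)
    then show "fls_nth f n = 0" by (simp only: fls_X_intpow_mult_nth) simp
  qed
next
  fix f :: "'a fls" assume f: "f \<in> fls_on {F<..}"
  have "f * g \<in> fls_on G" if "g \<in> fls_on {0..}" for g
    using f that by (rule mult_in_fls_on) (auto intro: G_gt)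
  then show "f \<in> conductor (fls_on G)"
    by (simp add: conductor_def colon_def power_series_ring_eq_fls_on fraction_field_ring)
qed

text \<open>Compare coefficients of \<open>f * inverse f = 1\<close> at a gap n. If i is a positive
  element of \<open>G\<close> with i at most n, then n - i is a smaller gap, so by induction only
  the term i = 0 survives. Thus the nonunits of the ring are its elements with zero constant
  term.\<close>

lemma inverse_in_ring:
  fixes f :: "'a::field fls"
  assumes f: "f \<in> fls_on G" and f0: "fls_nth f 0 \<noteq> 0"
  shows "inverse f \<in> fls_on G"
proof (rule fls_onI)
  have sub: "fls_subdegree f = 0"
  proof (rule fls_subdegree_eqI[OF f0])
    fix k :: int assume "k < 0"
    then show "fls_nth f k = 0" using G_nonneg[of k] by (intro fls_onD[OF f]) auto
  qed
  have fnz: "f \<noteq> 0" using f0 by auto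
  have neg: "fls_nth (inverse f) n = 0" if "n < 0" for n
    using that sub by simp
  have "int n \<notin> G \<Longrightarrow> fls_nth (inverse f) (int n) = 0" for n
  proof (induction n rule: less_induct)
    case (less n)
    have vanish: "fls_nth f i * fls_nth (inverse f) (int n - i) = 0" if "0 < i" for i
    proof (cases "i \<in> G \<and> i \<le> int n")
      case True
      then have "int (nat (int n - i)) \<notin> G" using G_add[of i "int n - i"] less.prems by auto
      moreover have "nat (int n - i) < n" using True that by auto
      ultimately show ?thesis using less.IH[of "nat (int n - i)"] True by simp
    next
      case False
      then show ?thesis using f neg[of "int n - i"] by (auto dest: fls_onD)
    qed
    have "n \<noteq> 0" using less.prems by (metis of_nat_0 zero_in_G)
    then have "0 = fls_nth (f * inverse f) (int n)" using fnz by simp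
    also have "\<dots> = (\<Sum>i = 0..int n. fls_nth f i * fls_nth (inverse f) (int n - i))"
      using sub by (simp add: fls_times_nth(2))
    also have "\<dots> = (\<Sum>i\<in>{0}. fls_nth f i * fls_nth (inverse f) (int n - i))"
      using vanish by (intro sum.mono_neutral_right) auto
    finally show ?case using f0 by simp
  qed
  then show "fls_nth (inverse f) n = 0" if "n \<notin> G" for n
    using that neg[of n] by (metis not_less zero_le_imp_eq_int)
qed

lemma max_ideal_ring: "max_ideal (fls_on G) = (fls_on (G - {0}) :: 'a::field fls set)"
proof -
  have "(\<exists>g\<in>fls_on G. f * g = 1) \<longleftrightarrow> fls_nth f 0 \<noteq> 0" if f: "f \<in> fls_on G" for f :: "'a fls"
  proof
    assume "\<exists>g\<in>fls_on G. f * g = 1"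
    then obtain g where g: "g \<in> fls_on G" "f * g = 1" by auto
    show "fls_nth f 0 \<noteq> 0"
    proof
      assume "fls_nth f 0 = 0"
      then have "f \<in> fls_on (G - {0})" using f by (auto simp: fls_on_def)
      moreover have "x + y \<in> {1..}" if "x \<in> G - {0}" "y \<in> G" for x y
        using that G_nonneg[of x] G_nonneg[of y] by auto
      ultimately have "f * g \<in> fls_on {1..}"
        using g(1) by (intro mult_in_fls_on)
      then show False using g(2)
        by (simp add: fls_on_def) (metis fls_one_nth not_one_le_zero zero_neq_one)
    qed
  next
    assume "fls_nth f 0 \<noteq> 0"
    then show "\<exists>g\<in>fls_on G. f * g = 1"
      using inverse_in_ring[OF f]
      by (intro bexI[of _ "inverse f"]) (auto intro: right_inverse)
  qed
  then have "max_ideal (fls_on G) = {f \<in> fls_on G. fls_nth f 0 = (0::'a)}"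
    unfolding max_ideal_def by blast
  also have "\<dots> = fls_on (G - {0})" by (auto simp: fls_on_def)
  finally show ?thesis .
qed

lemma colon_max_ideal:
  "colon (fls_on G) (fls_on ((+) e ` G)) (fls_on (G - {0}))
     = (fls_on ((+) e ` (G \<union> PF)) :: 'a::field fls set)"
proof (intro equalityI subsetI)
  fix f :: "'a fls"
  assume "f \<in> colon (fls_on G) (fls_on ((+) e ` G)) (fls_on (G - {0}))"
  then have f: "f \<in> fls_on G" "\<And>g. g \<in> fls_on (G - {0}) \<Longrightarrow> f * g \<in> fls_on ((+) e ` G)"
    by (auto simp: colon_def)
  show "f \<in> fls_on ((+) e ` (G \<union> PF))"
  proof (rule fls_onI)
    fix n assume n: "n \<notin> (+) e ` (G \<union> PF)"
    then have "n - e \<notin> G \<union> PF" using imageI[of "n - e" "G \<union> PF" "(+) e"] by auto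
    \<comment> \<open>Such an \<open>h\<close> shows that \<open>n - e\<close> is neither in
      \<open>G\<close> nor pseudo-Frobenius; t^h moves the coefficient at \<open>n\<close> to an
      exponent outside \<open>e + G\<close>.\<close>
    then obtain h where h: "h \<in> G - {0}" "n - e + h \<notin> G" by (auto simp: PF_def)
    have "fls_nth (f * fls_X_intpow h) (n + h) = 0"
      using h by (intro fls_onD[OF f(2)] fls_X_intpow_in_fls_on) (auto simp: algebra_simps)
    then show "fls_nth f n = 0" by (simp add: fls_X_intpow_mult_nth)
  qed
next
  fix f :: "'a fls" assume f: "f \<in> fls_on ((+) e ` (G \<union> PF))"
  \<comment> \<open>The colon is taken inside the ring; since \<open>e\<close> is a nonzero element
    of \<open>G\<close>, adding it sends \<open>PF\<close> into \<open>G\<close>.\<close>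
  have "(+) e ` (G \<union> PF) \<subseteq> G"
    using e_in_G e_pos by (auto simp: PF_def add.commute intro: G_add)
  then have "f \<in> fls_on G" using f fls_on_mono by blast
  moreover have "f * g \<in> fls_on ((+) e ` G)" if "g \<in> fls_on (G - {0})" for g
    using f that by (rule mult_in_fls_on) (auto simp: PF_def add.assoc intro: G_add)
  ultimately show "f \<in> colon (fls_on G) (fls_on ((+) e ` G)) (fls_on (G - {0}))"
    by (simp add: colon_def)
qed

section \<open>Type and reduced type as numbers of gaps\<close>

lemma CM_type_ring:
  "CM_type (least_generator H) (fls_on G :: 'a::field fls set) = card PF"
proof -
  have diff: "(+) e ` (G \<union> PF) - (+) e ` G = (+) e ` PF"
    by (auto simp: PF_def)
  have "CM_type (least_generator H) (fls_on G :: 'a fls set)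
      = quotient_dim (fls_on ((+) e ` (G \<union> PF))) (fls_on ((+) e ` G) :: 'a fls set)"
    by (simp only: CM_type_def principal_fls_on max_ideal_ring e_def[symmetric] colon_max_ideal)
  also have "\<dots> = card ((+) e ` (G \<union> PF) - (+) e ` G)"
  proof (rule quotient_dim_fls_on)
    show "finite ((+) e ` (G \<union> PF) - (+) e ` G)" unfolding diff using finite_PF by simp
  qed blast
  also have "\<dots> = card PF" unfolding diff by (intro card_image) simp
  finally show ?thesis .
qed

lemma reduced_type_ring:
  "reduced_type (least_generator H) (fls_on G :: 'a::field fls set) = card L"
proof -
  \<comment> \<open>The conductor exponents not already in t^e times the ring are the gaps above
    \<open>F - e\<close>, shifted by \<open>e\<close>.\<close>
  have diff: "{F<..} - (+) e ` G = (+) e ` L"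
  proof (intro equalityI subsetI)
    fix x assume "x \<in> {F<..} - (+) e ` G"
    then have "x = e + (x - e)" "x - e \<in> L" by (auto simp: L_def image_iff)
    then show "x \<in> (+) e ` L" by blast
  qed (auto simp: L_def)
  have fin: "finite ({F<..} - (+) e ` G)"
    unfolding diff using finite_subset[OF L_subset_PF finite_PF] by simp
  have Un: "{F<..} \<union> (+) e ` G - (+) e ` G = {F<..} - (+) e ` G"
    by blast
  have "reduced_type (least_generator H) (fls_on G :: 'a fls set)
      = quotient_dim (fls_on ({F<..} \<union> (+) e ` G)) (fls_on ((+) e ` G) :: 'a fls set)"
    by (simp only: reduced_type_def principal_fls_on conductor_ring e_def[symmetric]
        ideal_sum_fls_on[OF fin])
  also have "\<dots> = card ({F<..} - (+) e ` G)"
    using quotient_dim_fls_on[OF Un_upper2, of "{F<..}" "(+) e ` G"] fin unfolding Un by blast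
  also have "\<dots> = card L" unfolding diff by (intro card_image) simp
  finally show ?thesis .
qed

section \<open>Duality through the coefficient at \<open>F\<close>\<close>

lemma standard_canonical_iff:
  "f \<in> fls_on K \<longleftrightarrow> (\<forall>s\<in>fls_on G. fls_nth (s * f) F = 0)" for f :: "'a::field fls"
proof
  assume f: "f \<in> fls_on K"
  show "\<forall>s\<in>fls_on G. fls_nth (s * f) F = 0"
  proof
    fix s :: "'a fls" assume "s \<in> fls_on G"
    then have "s * f \<in> fls_on K"
      using f by (rule mult_in_fls_on) (metis K_add_G add.commute)
    then show "fls_nth (s * f) F = 0" by (rule fls_onD) (simp add: K_def)
  qed
next
  assume *: "\<forall>s\<in>fls_on G. fls_nth (s * f) F = 0"
  show "f \<in> fls_on K"
  proof (rule fls_onI)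
    fix n assume "n \<notin> K"
    \<comment> \<open>Outside \<open>K\<close>, the exponent \<open>F - n\<close> lies in
      \<open>G\<close>, so t^(F - n) is an admissible test element and reads off the coefficient at
      \<open>n\<close>.\<close>
    then have "fls_nth (fls_X_intpow (F - n) * f) F = 0"
      using * by (intro bspec[OF *] fls_X_intpow_in_fls_on) (simp add: K_def)
    then show "fls_nth f n = 0" by (simp only: fls_X_intpow_mult_nth) simp
  qed
qed

text \<open>The colon is the orthogonal complement of \<open>I\<close> for the pairing that sends
  (u, g) to the coefficient of u * g at \<open>F\<close>. As \<open>I\<close> is closed under the
  ring, this one coefficient controls all those outside \<open>K\<close>.\<close>

lemma colon_standard_canonical_iff:
  fixes I :: "'a::field fls set"
  assumes "submodule (fls_on G) I"
  shows "g \<in> colon UNIV (fls_on K) I \<longleftrightarrow> (\<forall>u\<in>I. fls_nth (u * g) F = 0)"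
proof
  assume g: "g \<in> colon UNIV (fls_on K) I"
  show "\<forall>u\<in>I. fls_nth (u * g) F = 0"
  proof
    fix u assume "u \<in> I"
    then have "g * u \<in> fls_on K" using g by (simp add: colon_def)
    then have "u * g \<in> fls_on K" by (simp only: mult.commute)
    then show "fls_nth (u * g) F = 0" by (rule fls_onD) (simp add: K_def)
  qed
next
  assume g: "\<forall>u\<in>I. fls_nth (u * g) F = 0"
  show "g \<in> colon UNIV (fls_on K) I"
    unfolding colon_def
  proof (intro CollectI conjI ballI)
    fix u assume u: "u \<in> I"
    show "g * u \<in> fls_on K"
      unfolding standard_canonical_iff
    proof
      fix s :: "'a fls" assume "s \<in> fls_on G"
      then have "s * u \<in> I" using assms u by (simp add: submodule_def)
      then have "fls_nth (s * u * g) F = 0" using g by blast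
      then show "fls_nth (s * (g * u)) F = 0" by (simp only: mult_ac)
    qed
  qed simp
qed

lemma submodule_subspace:
  assumes "submodule (fls_on G) I"
  shows "fls_vs.subspace I"
proof -
  have "fls_const c \<in> fls_on G" for c :: 'a by (auto simp: fls_on_def)
  then show ?thesis
    using assms by (auto simp: submodule_def fls_vs.subspace_def)
qed

text \<open>A series of sufficiently high order, divided by a fixed nonzero \<open>u\<close> in
  \<open>I\<close>, has order above \<open>F\<close> and so lies in the ring. Functionals vanishing
  on \<open>I\<close> therefore vanish on a tail and are coefficient functionals.\<close>

lemma fractional_ideal_contains_tail:
  fixes I :: "'a::field fls set"
  assumes "fractional_ideal (fls_on G) I"
  obtains N where "fls_on {N..} \<subseteq> I"
proof -
  have sub: "submodule (fls_on G) I" and "I \<noteq> {0}"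
    using assms by (auto simp: fractional_ideal_def)
  then obtain u where u: "u \<in> I" "u \<noteq> 0" by (auto simp: submodule_def)
  have "fls_on {F + 1 + fls_subdegree u..} \<subseteq> I"
  proof
    fix f :: "'a fls" assume f: "f \<in> fls_on {F + 1 + fls_subdegree u..}"
    have "f / u \<in> fls_on {F + 1..}"
      using f u(2) unfolding fls_on_atLeast_iff
      by (cases "f = 0") (simp_all add: fls_divide_subdegree)
    then have "f / u \<in> fls_on G" using fls_on_mono[of "{F + 1..}" G] G_gt by force
    then have "f / u * u \<in> I" using sub u(1) unfolding submodule_def by blast
    then show "f \<in> I" using u(2) by simp
  qed
  then show ?thesis by (rule that)
qed

text \<open>The nontrivial half of biduality. A functional separating \<open>f\<close> from
  \<open>I\<close> is multiplication by some \<open>g\<close> followed by taking the coefficient at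
  \<open>F\<close>. Then \<open>g\<close> lies in the dual of \<open>I\<close>, so
  \<open>f * g\<close> lies in \<open>fls_on K\<close> and has coefficient 0 at \<open>F\<close>,
  against \<phi> f = 1.\<close>

lemma standard_canonical_bidual:
  fixes I :: "'a::field fls set"
  assumes I: "fractional_ideal (fls_on G) I"
  shows "colon UNIV (fls_on K) (colon UNIV (fls_on K) I) \<subseteq> I"
proof (rule subsetI, rule ccontr)
  fix f assume f: "f \<in> colon UNIV (fls_on K) (colon UNIV (fls_on K) I)" "f \<notin> I"
  have sub: "submodule (fls_on G) I" using I by (simp add: fractional_ideal_def)
  obtain N where N: "fls_on {N..} \<subseteq> I" using fractional_ideal_contains_tail[OF I] .
  obtain \<phi> :: "'a fls \<Rightarrow> 'a" where \<phi>: "Vector_Spaces.linear (\<lambda>c f. fls_const c * f) (*) \<phi>"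
    "\<And>u. u \<in> I \<Longrightarrow> \<phi> u = 0" "\<phi> f = 1"
    by (rule separating_functional[OF submodule_subspace[OF sub] f(2)]) (rule that)
  have "\<phi> u = 0" if "u \<in> fls_on {N..}" for u using N \<phi>(2) that by blast
  then obtain g where g: "\<And>u. fls_nth (u * g) F = \<phi> u"
    by (rule functional_as_coefficient[OF \<phi>(1), where F = F]) (assumption, rule that)
  have "g \<in> colon UNIV (fls_on K) I"
    using g \<phi>(2) by (simp add: colon_standard_canonical_iff[OF sub])
  then have "f * g \<in> fls_on K" using f(1) by (simp add: colon_def)
  then have "fls_nth (f * g) F = 0" by (rule fls_onD) (simp add: K_def)
  then show False using g \<phi>(3) by simp
qed

lemma fractional_ideal_fls_on:
  assumes "0 \<in> X" "\<And>x. x \<in> X \<Longrightarrow> 0 \<le> x" "\<And>g x. g \<in> G \<Longrightarrow> x \<in> X \<Longrightarrow> g + x \<in> X"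
  shows "fractional_ideal (fls_on G) (fls_on X :: 'a::field fls set)"
  unfolding fractional_ideal_def
proof (intro conjI)
  show "submodule (fls_on G) (fls_on X :: 'a fls set)"
    unfolding submodule_def
    by (auto intro: add_in_fls_on mult_in_fls_on assms(3))
  show "fls_on X \<subseteq> fraction_field (fls_on G :: 'a fls set)"
    by (simp add: fraction_field_ring)
  show "fls_on X \<noteq> {0 :: 'a fls}"
    using one_in_fls_on[OF assms(1), where ?'a = 'a] by auto
  have "fls_X_intpow (F + 1) * u \<in> fls_on G" if u: "u \<in> fls_on X" for u :: "'a fls"
    using fls_X_intpow_in_fls_on[of "F + 1" "{F + 1}"] u
    by (rule mult_in_fls_on) (auto dest!: assms(2) intro: G_gt)
  moreover have "fls_X_intpow (F + 1) \<in> (fls_on G :: 'a fls set)"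
    by (intro fls_X_intpow_in_fls_on G_gt) simp
  ultimately show "\<exists>d\<in>fls_on G. d \<noteq> 0 \<and> (\<forall>u\<in>fls_on X. d * u \<in> (fls_on G :: 'a fls set))"
    using fls_X_intpow_nonzero by blast
qed

text \<open>A canonical ideal \<open>C\<close> is isomorphic to the standard one \<open>fls_on K\<close>: otherwise every product of
  an element of \<open>fls_on K : C\<close> and an element of \<open>C : fls_on K\<close> lies in the maximal ideal of
  \<open>C : C = fls_on G\<close>, and biduality then puts \<open>t\<^bsup>F\<^esup>\<close> into \<open>C : C\<close>.\<close>

lemma canonical_ideal_unique:
  fixes C :: "'a::field fls set"
  assumes "canonical_ideal (fls_on G) C"
  obtains a where "a \<noteq> 0" "C = (\<lambda>f. a * f) ` fls_on K"
proof -
  define P where "P = colon UNIV C (fls_on K)"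
  define Q where "Q = colon UNIV (fls_on K) C"
  have C: "fractional_ideal (fls_on G) C"
    and bid: "\<And>I. fractional_ideal (fls_on G) I \<Longrightarrow> colon UNIV C (colon UNIV C I) = I"
    using assms by (auto simp: canonical_ideal_def fraction_field_ring)
  have fG: "fractional_ideal (fls_on G) (fls_on G :: 'a fls set)"
    by (intro fractional_ideal_fls_on zero_in_G G_nonneg G_add)
  have fK: "fractional_ideal (fls_on G) (fls_on K :: 'a fls set)"
  proof (intro fractional_ideal_fls_on zero_in_K K_nonneg)
    show "g + k \<in> K" if "g \<in> G" "k \<in> K" for g k
      using K_add_G[OF that(2,1)] by (simp only: add.commute)
  qed
  have subC: "s * u \<in> C" if "s \<in> fls_on G" "u \<in> C" for s u
    using C that by (auto simp: fractional_ideal_def submodule_def)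
  have one: "1 \<in> (fls_on G :: 'a fls set)" by (simp add: one_in_fls_on)
  have "colon UNIV C (fls_on G) = C"
  proof (intro equalityI subsetI)
    fix f assume "f \<in> colon UNIV C (fls_on G)"
    then have "f * 1 \<in> C" using one unfolding colon_def by blast
    then show "f \<in> C" by simp
  next
    fix f assume f: "f \<in> C"
    have "f * s \<in> C" if "s \<in> fls_on G" for s
      using subC[OF that f] by (simp only: mult.commute)
    then show "f \<in> colon UNIV C (fls_on G)" by (simp add: colon_def)
  qed
  \<comment> \<open>Biduality with respect to \<open>C\<close>, applied to the ring itself.\<close>
  then have CC: "colon UNIV C C = fls_on G" using bid[OF fG] by simp
  have P: "p * k \<in> C" if "p \<in> P" "k \<in> fls_on K" for p k
    using that by (simp add: P_def colon_def)
  have Q: "q * u \<in> fls_on K" if "q \<in> Q" "u \<in> C" for q u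
    using that by (simp add: Q_def colon_def)
  have PQ: "p * q \<in> fls_on G" if "p \<in> P" "q \<in> Q" for p q
  proof -
    have "p * q * u \<in> C" if "u \<in> C" for u
      using P[OF \<open>p \<in> P\<close> Q[OF \<open>q \<in> Q\<close> that]] by (simp only: mult.assoc)
    then show ?thesis unfolding CC[symmetric] by (simp add: colon_def)
  qed
  have "\<exists>a\<in>P. \<exists>b\<in>Q. fls_nth (a * b) 0 \<noteq> 0"
  proof (rule ccontr)
    let ?t = "fls_X_intpow F :: 'a fls"
    assume "\<not> ?thesis"
    then have zero: "fls_nth (p * q) 0 = 0" if "p \<in> P" "q \<in> Q" for p q using that by blast
    \<comment> \<open>With zero constant term, \<open>p * q\<close> has only positive exponents,
      which t^F pushes above \<open>F\<close>.\<close>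
    have tPQ: "?t * (p * q) \<in> fls_on G" if "p \<in> P" "q \<in> Q" for p q
    proof -
      have pq: "p * q \<in> fls_on (G - {0})"
        using PQ[OF that] zero[OF that] by (auto simp: fls_on_def)
      have "?t \<in> fls_on {F}" by (rule fls_X_intpow_in_fls_on) (rule singletonI)
      moreover have "x + y \<in> G" if "x \<in> {F}" "y \<in> G - {0}" for x y
        using that G_nonneg[of y] by (intro G_gt) auto
      ultimately show ?thesis by (rule mult_in_fls_on[OF _ pq])
    qed
    \<comment> \<open>Biduality of \<open>fls_on K\<close> with respect to \<open>C\<close> removes
      the factor \<open>p\<close>.\<close>
    have tQ: "?t * q * u \<in> fls_on K" if q: "q \<in> Q" and u: "u \<in> C" for q u
    proof -
      have "?t * q * u * p \<in> C" if "p \<in> P" for p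
        using subC[OF tPQ[OF that q] u] by (simp only: mult_ac)
      then have "?t * q * u \<in> colon UNIV C P" by (simp add: colon_def)
      then show ?thesis using bid[OF fK] by (simp add: P_def)
    qed
    \<comment> \<open>Symmetrically, biduality of \<open>C\<close> with respect to
      \<open>fls_on K\<close> removes \<open>q\<close>.\<close>
    have "?t * u \<in> C" if u: "u \<in> C" for u
    proof -
      have "?t * u * q \<in> fls_on K" if "q \<in> Q" for q
        using tQ[OF that u] by (simp only: mult_ac)
      then have "?t * u \<in> colon UNIV (fls_on K) Q" by (simp add: colon_def)
      then show ?thesis using standard_canonical_bidual[OF C] by (auto simp: Q_def)
    qed
    then have "?t \<in> fls_on G" unfolding CC[symmetric] by (simp add: colon_def)
    then have "fls_nth ?t F = 0" using F_notin_G by (blast dest: fls_onD)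
    then show False by simp
  qed
  then obtain a b where ab: "a \<in> P" "b \<in> Q" "fls_nth (a * b) 0 \<noteq> 0" by blast
  then have nz: "a \<noteq> 0" "b \<noteq> 0" by auto
  \<comment> \<open>Now \<open>a * b\<close> is a unit of the ring, so multiplication by
    \<open>b\<close> and by its inverse undoes multiplication by \<open>a\<close>.\<close>
  have "C = (\<lambda>f. a * f) ` fls_on K"
  proof (intro equalityI subsetI)
    fix u assume u: "u \<in> C"
    have "inverse (a * b) * u \<in> C"
      using inverse_in_ring[OF PQ[OF ab(1,2)] ab(3)] u by (rule subC)
    then have "b * (inverse (a * b) * u) \<in> fls_on K" by (rule Q[OF ab(2)])
    moreover have "a * (b * (inverse (a * b) * u)) = a * b * inverse (a * b) * u"
      by (simp only: mult.assoc)
    then have "u = a * (b * (inverse (a * b) * u))"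
      using right_inverse[of "a * b"] nz by simp
    ultimately show "u \<in> (\<lambda>f. a * f) ` fls_on K" by blast
  qed (use P[OF ab(1)] in auto)
  with nz(1) show ?thesis by (rule that)
qed

section \<open>Consequences of the far-flung Gorenstein property\<close>

lemma far_flung_colon:
  assumes "far_flung_Gorenstein (fls_on G :: 'a::field fls set)"
    and x: "\<And>k. k \<in> fls_on K \<Longrightarrow> x * k \<in> (fls_on G :: 'a fls set)"
  shows "x \<in> fls_on {F<..}"
proof -
  obtain C where "canonical_ideal (fls_on G) C"
    and tr: "trace_ideal (fls_on G) C = (fls_on {F<..} :: 'a fls set)"
    using assms(1) by (auto simp: far_flung_Gorenstein_def conductor_ring)
  then obtain a where a: "a \<noteq> 0" "C = (\<lambda>f. a * f) ` fls_on K"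
    by (auto elim: canonical_ideal_unique)
  \<comment> \<open>On u = a * k this map gives x * k, which lies in the ring; its value at
    \<open>a\<close> itself exhibits \<open>x\<close> as a one-term sum in the trace ideal.\<close>
  have "(\<lambda>u. x / a * u) \<in> Hom_to_ring (fls_on G) C"
    unfolding Hom_to_ring_def
  proof (intro CollectI conjI ballI funcsetI)
    fix u assume "u \<in> C"
    then show "x / a * u \<in> fls_on G" using x a by auto
  qed (simp_all only: distrib_left mult.left_commute)
  moreover have "a \<in> C" using a(2) one_in_fls_on[OF zero_in_K] by force
  ultimately have "(\<Sum>i<1::nat. x / a * a) \<in> trace_ideal (fls_on G) C"
    unfolding trace_ideal_def
    by (intro CollectI exI[of _ 1] exI[of _ "\<lambda>_ u. x / a * u"] exI[of _ "\<lambda>_. a"])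
      (simp only: simp_thms)
  moreover have "(\<Sum>i<1::nat. x / a * a) = x" using a(1) by simp
  ultimately show ?thesis unfolding tr by (simp only:)
qed

text \<open>If y had no such decomposition, t^(F - y) would multiply \<open>fls_on K\<close> into
  the ring and hence lie in the conductor, although its exponent is at most
  \<open>F\<close>.\<close>

lemma far_flung_sumset:
  assumes "far_flung_Gorenstein (fls_on G :: 'a::field fls set)" and "0 \<le> y"
  obtains k where "k \<in> K" "y - k \<in> K"
proof -
  have "\<exists>k\<in>K. F - y + k \<notin> G"
  proof (rule ccontr)
    assume "\<not> ?thesis"
    then have sub: "x + k \<in> G" if "x \<in> {F - y}" "k \<in> K" for x k using that by blast
    have "fls_X_intpow (F - y) \<in> (fls_on {F - y} :: 'a fls set)"
      by (rule fls_X_intpow_in_fls_on) (rule singletonI)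
    then have "fls_X_intpow (F - y) * k \<in> (fls_on G :: 'a fls set)" if "k \<in> fls_on K" for k
      using that sub by (rule mult_in_fls_on)
    then have "fls_X_intpow (F - y) \<in> (fls_on {F<..} :: 'a fls set)"
      by (rule far_flung_colon[OF assms(1)])
    then have "fls_nth (fls_X_intpow (F - y) :: 'a fls) (F - y) = 0"
      by (rule fls_onD) (use assms(2) in simp)
    then show False by simp
  qed
  then obtain k where k: "k \<in> K" "F - y + k \<notin> G" by blast
  have "F - (y - k) = F - y + k" by simp
  then have "y - k \<in> K" using k(2) by (simp only: K_def mem_Collect_eq not_False_eq_True)
  with k(1) show ?thesis by (rule that)
qed

lemma far_flung_type_le:
  assumes ff: "far_flung_Gorenstein (fls_on G :: 'a::field fls set)"
    and e: "Rohrbach (card PF - 1) < least_generator H"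
  shows "card PF \<le> card L"
proof (rule ccontr)
  assume less: "\<not> card PF \<le> card L"
  define A where "A = (\<lambda>x. nat (F - x)) ` L"
  have fL: "finite L" using finite_subset[OF L_subset_PF finite_PF] .
  have "finite A" using fL by (simp add: A_def)
  \<comment> \<open>The assumed strict inequality makes \<open>card PF\<close> positive, so the
    subtraction does not truncate.\<close>
  moreover have "card A \<le> card PF - 1"
    using card_image_le[OF fL, of "\<lambda>x. nat (F - x)"] less by (simp add: A_def)
  moreover have "\<exists>a\<in>A. \<exists>b\<in>A. n = a + b" if n: "n < least_generator H" for n
  proof -
    obtain k where k: "k \<in> K" "int n - k \<in> K" using far_flung_sumset[OF ff, of "int n"] by auto
    have A: "nat j \<in> A" if "j \<in> K" "j < e" for j
    proof -
      have "F - j \<in> L" using that by (auto simp: L_def K_def)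
      then show ?thesis unfolding A_def by force
    qed
    \<comment> \<open>Elements of \<open>K\<close> are nonnegative, so both summands are at most
      \<open>n\<close>, hence below \<open>e\<close>, and already belong to
      \<open>A\<close>.\<close>
    have "0 \<le> k" "0 \<le> int n - k" "int n < e"
      using K_nonneg[OF k(1)] K_nonneg[OF k(2)] n by (auto simp: e_def)
    then have "nat k \<in> A" "nat (int n - k) \<in> A" "n = nat k + nat (int n - k)"
      using k by (auto intro: A)
    then show ?thesis by blast
  qed
  ultimately have "least_generator H \<le> Rohrbach (card PF - 1)"
    by (rule Rohrbach_ge)
  then show False using e by simp
qed

end

theorem theorem3p26:
  fixes H :: "nat set"
    and S :: "'k::{alg_closed_field, field_char_0} fls set"
    and r :: nat
  assumes "numerical_semigroup H"
    and "H \<noteq> UNIV"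
    and "S = semigroup_ring H"
    and "far_flung_Gorenstein S"
    and "CM_type (least_generator H) S = r"
    and "least_generator H > Rohrbach (r - 1) + 1"
  shows "maximal_reduced_type (least_generator H) S"
proof -
  interpret proper_numerical_semigroup H using assms(1,2) by unfold_locales
  have S: "S = fls_on G" using assms(3) by (simp add: semigroup_ring_eq_fls_on G_def)
  have "r = card PF" using assms(5) by (simp add: S CM_type_ring)
  then have "card PF \<le> card L"
    using assms(4,6) far_flung_type_le[where ?'a = 'k] by (simp add: S)
  moreover have "card L \<le> card PF" by (rule card_mono[OF finite_PF L_subset_PF])
  ultimately show ?thesis
    by (simp add: maximal_reduced_type_def S CM_type_ring reduced_type_ring)
qed

end
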